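(* Let $\varepsilon\in\{1,-1\}$ and let $q,\ell$ be odd primes such that $2^rq^s=\ell^{2t-1}-\varepsilon$ for some positive integers $r,s,t$. Then $\ell=2^rq^m+\varepsilon$ for some integer $m$ with $0\le m\le s$. *)

theory Defs
  imports Complex_Main "HOL-Computational_Algebra.Primes"
begin

end

(* Put n = 2t - 1.  As n is odd, \<epsilon>^n = \<epsilon>, so l - \<epsilon> divides 2^r q^s, and the cofactor
   is a sum of n odd terms, hence odd.  So 2^r divides l - \<epsilon>, and the quotient is a
   positive divisor of q^s. *)
theory Submission
  imports Defs
begin

lemma odd_power_diff_cofactor:
  fixes x y :: int
  assumes "odd x" and "odd y" and "odd n"
  obtains S where "x ^ n - y ^ n = (x - y) * S" and "odd S"
proof
  let ?S = "\<Sum>i<n. y ^ (n - Suc i) * x ^ i"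
  show "x ^ n - y ^ n = (x - y) * ?S"
    by (rule power_diff_sumr2)
  show "odd ?S"
    \<comment> \<open>\<open>even_sum_iff\<close> reduces parity to counting the odd summands: all n
      of them are odd, and n is odd.\<close>
    using assms by (simp add: even_sum_iff)
qed

theorem theorem1p4:
  fixes \<epsilon> :: int and q l r s t :: nat
  assumes "\<epsilon> \<in> {1, -1}"
    and "prime q" and "odd q"
    and "prime l" and "odd l"
    and "r > 0" and "s > 0" and "t > 0"
    and "2 ^ r * int q ^ s = int l ^ (2 * t - 1) - \<epsilon>"
  shows "\<exists>m::nat. m \<le> s \<and> int l = 2 ^ r * int q ^ m + \<epsilon>"
proof -
  have n: "odd (2 * t - 1)"
    using \<open>t > 0\<close> by simp
  \<comment> \<open>This turns the right-hand side into a difference of equal odd powers, with x = l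
    and y = \<epsilon>.\<close>
  have "odd \<epsilon>" and "\<epsilon> ^ (2 * t - 1) = \<epsilon>"
    using assms(1) n by auto
  with assms(9) n \<open>odd l\<close> obtain S
    where S: "2 ^ r * int q ^ s = (int l - \<epsilon>) * S" and "odd S"
    by (metis odd_power_diff_cofactor even_of_nat_iff)
  have "coprime (2 ^ r) S"
    using \<open>odd S\<close> by simp
  then have "2 ^ r dvd int l - \<epsilon>"
    by (metis S coprime_dvd_mult_left_iff dvd_triv_left)
  then obtain k where k: "int l - \<epsilon> = 2 ^ r * k" ..
  have "l > 1"
    using \<open>prime l\<close> by (rule prime_gt_1_nat)
  \<comment> \<open>Since l > 1 \<ge> \<epsilon>, the difference cannot vanish, even for \<epsilon>
    = 1.\<close>
  then have "2 ^ r * k > 0"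
    using assms(1) k by auto
  then have "k > 0"
    by (simp add: zero_less_mult_iff)
  have "int q ^ s = k * S"
    using S k by simp
  \<comment> \<open>Over the integers a divisor of q^s is a power of q only up to sign. As k > 0,
    passing to \<open>nat k\<close> loses nothing and settles the sign.\<close>
  then have "int (nat k) dvd int (q ^ s)"
    using \<open>k > 0\<close> by simp
  then have "nat k dvd q ^ s"
    by (simp only: int_dvd_int_iff)
  with \<open>prime q\<close> obtain m where "m \<le> s" and "nat k = q ^ m"
    by (auto simp: divides_primepow_nat)
  then have "k = int q ^ m"
    using \<open>k > 0\<close> by (metis int_nat_eq of_nat_power order_less_imp_le)
  with k \<open>m \<le> s\<close> show ?thesis
    by (metis diff_add_cancel)
qed

end
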